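(* Let $n\ge2$ and let $\lambda\in P^+$. There is a bijective correspondence $$\{\text{solutions to the tropical critical conditions with highest weight }\lambda\}\longleftrightarrow\{\text{ideal fillings for }\lambda\},$$ which sends a solution $(\sigma_a)_{a\in\mathcal{A}}$ to the filling $\{n_{ij}\}_{1\le i<j\le n}$ given by $n_{ij}=\pi(v_{ji})$, where for $v\in\mathcal{V}^\bullet$ $$\pi(v):=\min_{a:\,h(a)=v}\sigma_a=\min_{a:\,t(a)=v}\sigma_a .$$ Furthermore, the bijection preserves integrality: all $\sigma_a$ are integers if and only if all $n_{ij}$ of the corresponding filling are integers.
   Context: Weights. $P^+$ is the set of dominant integral weights of $SL_n(\mathbb{C})$, i.e. classes in $X^*(T)=\mathbb{Z}^n/\mathbb{Z}(1,\dots,1)$ of $(\lambda_1,\dots,\lambda_n)$ with $\lambda_1\ge\dots\ge\lambda_n$. For $i\ne j$, $\alpha_{ij}=\epsilon_i-\epsilon_j$, where $\epsilon_i$ is the class of the $i$-th standard basis vector. Quiver. Vertices $v_{ij}$, $1\le j\le i\le n$, placed as the lower triangular matrix entries (row $i$, column $j$). $\mathcal{V}^*=\{v_{11},\dots,v_{nn}\}$ (star vertices), $\mathcal{V}^\bullet=\{v_{ij}:j<i\}$, $\mathcal{V}=\mathcal{V}^*\sqcup\mathcal{V}^\bullet$. The arrow set $\mathcal{A}$ consists of the vertical arrows $v_{i+1,j}\to v_{ij}$ ($1\le j\le i\le n-1$) and the horizontal arrows $v_{i,j+1}\to v_{ij}$ ($1\le j<i\le n$). $h(a),t(a)$ are the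 head and tail of the arrow $a$. A solution to the tropical critical conditions with highest weight $\lambda$ is a tuple $(\sigma_a)_{a\in\mathcal{A}}\in\mathbb{R}^{\mathcal{A}}$ of the form $\sigma_a=\delta_{h(a)}-\delta_{t(a)}$ for some $(\delta_v)\in\mathbb{R}^{\mathcal{V}}$ with $\delta_{v_{ii}}=\lambda_i$ for $i=1,\dots,n$ (where $(\lambda_1,\dots,\lambda_n)$ is any representative of $\lambda$; the set of such $(\sigma_a)$ does not depend on the representative), such that for every $v\in\mathcal{V}^\bullet$: $\min_{a:h(a)=v}\sigma_a=\min_{a:t(a)=v}\sigma_a$. A filling is a collection of non-negative real numbers $\{n_{ij}\}_{1\le i<j\le n}$. It is ideal if $n_{ij}=\max\{n_{i+1,j},n_{i,j-1}\}$ whenever $j-i\ge2$. It is an ideal filling for $\lambda$ if it is ideal and $\sum_{i<j}n_{ij}\alpha_{ij}=\lambda$ in $X^*(T)\otimes\mathbb{R}=\mathbb{R}^n/\mathbb{R}(1,\dots,1)$. *)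

theory Defs
  imports Complex_Main "HOL-Library.FuncSet"
begin

text \<open>
  Weights. The quotients of \<open>\<int>\<^sup>n\<close> by \<open>\<int>(1,\<dots>,1)\<close> and of \<open>\<real>\<^sup>n\<close> by \<open>\<real>(1,\<dots>,1)\<close> are both
  sets of equivalence classes of \<open>diag_rel n\<close>, at type \<^typ>\<open>int\<close> and \<^typ>\<open>real\<close> respectively.
  Vectors are extensional functions on \<open>{1..n}\<close>, so that each class is an honest coset.
\<close>

definition diag_rel :: "nat \<Rightarrow> ((nat \<Rightarrow> 'a::ab_group_add) \<times> (nat \<Rightarrow> 'a)) set" where
  "diag_rel n = {(x, y). x \<in> {1..n} \<rightarrow>\<^sub>E UNIV \<and> y \<in> {1..n} \<rightarrow>\<^sub>E UNIV \<and>
                         (\<exists>c. \<forall>i\<in>{1..n}. y i = x i + c)}"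

lemma equiv_diag_rel: "equiv ({1..n} \<rightarrow>\<^sub>E UNIV) (diag_rel n)"
proof (rule equivI)
  show "diag_rel n \<subseteq> ({1..n} \<rightarrow>\<^sub>E (UNIV :: 'a set)) \<times> ({1..n} \<rightarrow>\<^sub>E UNIV)"
    by (auto simp: diag_rel_def)
  show "refl_on ({1..n} \<rightarrow>\<^sub>E (UNIV :: 'a set)) (diag_rel n)"
    by (auto simp: refl_on_def diag_rel_def intro: exI[of _ 0])
  show "sym (diag_rel n :: ((nat \<Rightarrow> 'a) \<times> (nat \<Rightarrow> 'a)) set)"
  proof (rule symI)
    fix x y :: "nat \<Rightarrow> 'a" assume "(x, y) \<in> diag_rel n"
    then obtain c where xy: "x \<in> {1..n} \<rightarrow>\<^sub>E UNIV" "y \<in> {1..n} \<rightarrow>\<^sub>E UNIV"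
      and c: "\<forall>i\<in>{1..n}. y i = x i + c"
      by (auto simp: diag_rel_def)
    from c have "\<forall>i\<in>{1..n}. x i = y i + (- c)" by simp
    with xy show "(y, x) \<in> diag_rel n" unfolding diag_rel_def by blast
  qed
  show "trans (diag_rel n :: ((nat \<Rightarrow> 'a) \<times> (nat \<Rightarrow> 'a)) set)"
  proof (rule transI)
    fix x y z :: "nat \<Rightarrow> 'a" assume "(x, y) \<in> diag_rel n" "(y, z) \<in> diag_rel n"
    then obtain c d where xz: "x \<in> {1..n} \<rightarrow>\<^sub>E UNIV" "z \<in> {1..n} \<rightarrow>\<^sub>E UNIV"
      and c: "\<forall>i\<in>{1..n}. y i = x i + c" and d: "\<forall>i\<in>{1..n}. z i = y i + d"
      unfolding diag_rel_def by blast
    from c d have "\<forall>i\<in>{1..n}. z i = x i + (c + d)" by (simp add: add.assoc)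
    with xz show "(x, z) \<in> diag_rel n" unfolding diag_rel_def by blast
  qed
qed

definition weight_class :: "nat \<Rightarrow> (nat \<Rightarrow> 'a::ab_group_add) \<Rightarrow> (nat \<Rightarrow> 'a) set" where
  "weight_class n x = diag_rel n `` {restrict x {1..n}}"

definition dominant_weights :: "nat \<Rightarrow> (nat \<Rightarrow> int) set set" where
  "dominant_weights n = {weight_class n l | l. \<forall>i j. 1 \<le> i \<longrightarrow> i \<le> j \<longrightarrow> j \<le> n \<longrightarrow> l j \<le> l i}"

text \<open>
  The image of a class in \<open>\<int>\<^sup>n/\<int>(1,\<dots>,1)\<close> in \<open>\<real>\<^sup>n/\<real>(1,\<dots>,1)\<close>. The union is over
  representatives, all of which contribute the same class.
\<close>

definition real_weight :: "nat \<Rightarrow> (nat \<Rightarrow> int) set \<Rightarrow> (nat \<Rightarrow> real) set" where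
  "real_weight n lam = (\<Union>l\<in>lam. weight_class n (\<lambda>k. real_of_int (l k)))"

lemma real_weight_weight_class:
  "real_weight n (weight_class n l) = weight_class n (\<lambda>k. real_of_int (l k))"
proof -
  have same: "weight_class n (\<lambda>k. real_of_int (l' k)) = weight_class n (\<lambda>k. real_of_int (l k))"
    if l': "l' \<in> weight_class n l" for l'
  proof -
    obtain c where c: "\<forall>i\<in>{1..n}. l' i = l i + c"
      using l' by (auto simp: weight_class_def diag_rel_def)
    then have "(restrict (\<lambda>k. real_of_int (l k)) {1..n},
                restrict (\<lambda>k. real_of_int (l' k)) {1..n}) \<in> diag_rel n"
      by (auto simp: diag_rel_def intro!: exI[of _ "real_of_int c"])
    from equiv_class_eq[OF equiv_diag_rel this] show ?thesis
      by (simp add: weight_class_def)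
  qed
  have "restrict l {1..n} \<in> weight_class n l"
    by (auto simp: weight_class_def diag_rel_def intro: exI[of _ 0])
  with same show ?thesis
    unfolding real_weight_def by blast
qed

definition eps :: "nat \<Rightarrow> nat \<Rightarrow> real" where
  "eps i = (\<lambda>k. if k = i then 1 else 0)"

text \<open>A representative in \<open>\<real>\<^sup>n\<close> of the root \<open>\<alpha>\<^sub>i\<^sub>j\<close>.\<close>

definition root_vec :: "nat \<Rightarrow> nat \<Rightarrow> nat \<Rightarrow> real" where
  "root_vec i j = (\<lambda>k. eps i k - eps j k)"

text \<open>
  Quiver. The vertex \<open>v\<^sub>i\<^sub>j\<close> is the pair \<open>(i, j)\<close> and an arrow is the pair (tail, head);
  there is at most one arrow between two vertices.
\<close>

type_synonym vertex = "nat \<times> nat"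
type_synonym arrow = "vertex \<times> vertex"

definition star_vertices :: "nat \<Rightarrow> vertex set" where
  "star_vertices n = {(i, i) | i. 1 \<le> i \<and> i \<le> n}"

definition bullet_vertices :: "nat \<Rightarrow> vertex set" where
  "bullet_vertices n = {(i, j) | i j. 1 \<le> j \<and> j < i \<and> i \<le> n}"

definition vertices :: "nat \<Rightarrow> vertex set" where
  "vertices n = star_vertices n \<union> bullet_vertices n"

definition vertical_arrows :: "nat \<Rightarrow> arrow set" where
  "vertical_arrows n = {((i + 1, j), (i, j)) | i j. 1 \<le> j \<and> j \<le> i \<and> i \<le> n - 1}"

definition horizontal_arrows :: "nat \<Rightarrow> arrow set" where
  "horizontal_arrows n = {((i, j + 1), (i, j)) | i j. 1 \<le> j \<and> j < i \<and> i \<le> n}"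

definition arrows :: "nat \<Rightarrow> arrow set" where
  "arrows n = vertical_arrows n \<union> horizontal_arrows n"

abbreviation tail :: "arrow \<Rightarrow> vertex" where "tail a \<equiv> fst a"
abbreviation head :: "arrow \<Rightarrow> vertex" where "head a \<equiv> snd a"

definition arrows_into :: "nat \<Rightarrow> vertex \<Rightarrow> arrow set" where
  "arrows_into n v = {a \<in> arrows n. head a = v}"

definition arrows_out_of :: "nat \<Rightarrow> vertex \<Rightarrow> arrow set" where
  "arrows_out_of n v = {a \<in> arrows n. tail a = v}"

lemma arrows_subset: "arrows n \<subseteq> vertices n \<times> vertices n"
  by (auto simp: arrows_def vertical_arrows_def horizontal_arrows_def vertices_def
      star_vertices_def bullet_vertices_def)

lemma finite_arrows: "finite (arrows n)"
proof (rule finite_subset[OF arrows_subset])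
  have "vertices n \<subseteq> {1..n} \<times> {1..n}"
    by (auto simp: vertices_def star_vertices_def bullet_vertices_def)
  then show "finite (vertices n \<times> vertices n)"
    by (meson finite_SigmaI finite_atLeastAtMost finite_subset)
qed

text \<open>At a bullet vertex the minima below are therefore taken over finite nonempty sets.\<close>

lemma arrows_at_bullet:
  assumes "v \<in> bullet_vertices n"
  shows "finite (arrows_into n v)" "arrows_into n v \<noteq> {}"
    and "finite (arrows_out_of n v)" "arrows_out_of n v \<noteq> {}"
proof -
  obtain i j where v: "v = (i, j)" "1 \<le> j" "j < i" "i \<le> n"
    using assms by (auto simp: bullet_vertices_def)
  have "((i, j + 1), (i, j)) \<in> arrows_into n v"
    using v by (auto simp: arrows_into_def arrows_def horizontal_arrows_def)
  then show "arrows_into n v \<noteq> {}" by blast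
  have "((i - 1 + 1, j), (i - 1, j)) \<in> vertical_arrows n"
    using v unfolding vertical_arrows_def by force
  then have "((i, j), (i - 1, j)) \<in> arrows_out_of n v"
    using v by (simp add: arrows_out_of_def arrows_def)
  then show "arrows_out_of n v \<noteq> {}" by blast
qed (simp_all add: arrows_into_def arrows_out_of_def finite_arrows)

text \<open>
  The tuples \<open>(\<delta>\<^bsub>h(a)\<^esub> - \<delta>\<^bsub>t(a)\<^esub>)\<close> with \<open>\<delta>\<close> prescribed on the star vertices by a given
  representative \<open>l\<close> of the weight.
\<close>

definition potential_differences :: "nat \<Rightarrow> (nat \<Rightarrow> int) \<Rightarrow> (arrow \<Rightarrow> real) set" where
  "potential_differences n l =
     {\<sigma> \<in> arrows n \<rightarrow>\<^sub>E UNIV.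
        \<exists>\<delta> :: vertex \<Rightarrow> real. (\<forall>i\<in>{1..n}. \<delta> (i, i) = real_of_int (l i)) \<and>
            (\<forall>a\<in>arrows n. \<sigma> a = \<delta> (head a) - \<delta> (tail a))}"

lemma potential_differences_mono:
  assumes "(l, l') \<in> diag_rel n"
  shows "potential_differences n l \<subseteq> potential_differences n l'"
proof
  fix \<sigma> assume "\<sigma> \<in> potential_differences n l"
  then obtain \<delta> where \<sigma>: "\<sigma> \<in> arrows n \<rightarrow>\<^sub>E UNIV"
    and \<delta>: "\<forall>i\<in>{1..n}. \<delta> (i, i) = real_of_int (l i)"
      "\<forall>a\<in>arrows n. \<sigma> a = \<delta> (head a) - \<delta> (tail a)"
    by (auto simp: potential_differences_def)
  obtain c where c: "\<forall>i\<in>{1..n}. l' i = l i + c"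
    using assms by (auto simp: diag_rel_def)
  define \<delta>' where "\<delta>' v = \<delta> v + real_of_int c" for v
  have "\<forall>i\<in>{1..n}. \<delta>' (i, i) = real_of_int (l' i)"
    "\<forall>a\<in>arrows n. \<sigma> a = \<delta>' (head a) - \<delta>' (tail a)"
    using \<delta> c by (simp_all add: \<delta>'_def)
  with \<sigma> show "\<sigma> \<in> potential_differences n l'"
    unfolding potential_differences_def by blast
qed

lemma potential_differences_cong:
  "(l, l') \<in> diag_rel n \<Longrightarrow> potential_differences n l = potential_differences n l'"
  using equivE[OF equiv_diag_rel] potential_differences_mono
  by (metis subset_antisym symD)

definition tropical_solutions :: "nat \<Rightarrow> (nat \<Rightarrow> int) set \<Rightarrow> (arrow \<Rightarrow> real) set" where
  "tropical_solutions n lam =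
     {\<sigma>. (\<exists>l\<in>lam. \<sigma> \<in> potential_differences n l) \<and>
         (\<forall>v\<in>bullet_vertices n. Min (\<sigma> ` arrows_into n v) = Min (\<sigma> ` arrows_out_of n v))}"

text \<open>On a solution, the minimum over outgoing arrows gives the same value.\<close>

definition min_slope :: "nat \<Rightarrow> (arrow \<Rightarrow> real) \<Rightarrow> vertex \<Rightarrow> real" where
  "min_slope n \<sigma> v = Min (\<sigma> ` arrows_into n v)"

definition filling_index :: "nat \<Rightarrow> (nat \<times> nat) set" where
  "filling_index n = {(i, j) | i j. 1 \<le> i \<and> i < j \<and> j \<le> n}"

definition fillings :: "nat \<Rightarrow> (nat \<times> nat \<Rightarrow> real) set" where
  "fillings n = filling_index n \<rightarrow>\<^sub>E {0..}"

definition ideal_fillings :: "nat \<Rightarrow> (nat \<times> nat \<Rightarrow> real) set" where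
  "ideal_fillings n =
     {N \<in> fillings n. \<forall>(i, j)\<in>filling_index n. j - i \<ge> 2 \<longrightarrow>
        N (i, j) = max (N (i + 1, j)) (N (i, j - 1))}"

definition ideal_fillings_for :: "nat \<Rightarrow> (nat \<Rightarrow> int) set \<Rightarrow> (nat \<times> nat \<Rightarrow> real) set" where
  "ideal_fillings_for n lam =
     {N \<in> ideal_fillings n.
        weight_class n (\<lambda>k. \<Sum>(i, j)\<in>filling_index n. N (i, j) * root_vec i j k)
          = real_weight n lam}"

text \<open>The transposition of indices is intended: \<open>n\<^sub>i\<^sub>j\<close> is read off at the vertex \<open>v\<^sub>j\<^sub>i\<close>.\<close>

definition filling_of :: "nat \<Rightarrow> (arrow \<Rightarrow> real) \<Rightarrow> (nat \<times> nat \<Rightarrow> real)" where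
  "filling_of n \<sigma> = restrict (\<lambda>(i, j). min_slope n \<sigma> (j, i)) (filling_index n)"

end

theory Submission imports Defs begin

text \<open>
  Let \<open>p v\<close> be the common minimum at the bullet vertex \<open>v\<close>. Each unit box of the quiver has two
  paths from its lower right to its upper left corner, and comparing the potential along them gives
  \<open>p(i + 1, j) = max (p(i, j)) (p(i + 1, j + 1))\<close> and shows that, up to a constant, the potential is
  \<open>(i, j) \<mapsto> (\<Sum>k>i. p(k, j)) - (\<Sum>k<j. p(i, k))\<close>. Its values on the diagonal are the coordinates of
  \<open>\<Sum>n\<^sub>i\<^sub>j \<alpha>\<^sub>i\<^sub>j\<close>, so a solution is determined by its filling. Conversely, this formula applied to an
  ideal filling gives a solution, because whenever two adjacent columns (rows) of an ideal filling
  agree in one place, they agree from there on away from the diagonal.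
\<close>

section \<open>Critical potentials\<close>

definition in_slope :: "nat \<Rightarrow> (vertex \<Rightarrow> real) \<Rightarrow> vertex \<Rightarrow> real" where
  "in_slope n d = (\<lambda>(i, j). if i < n then min (d (i, j) - d (i + 1, j)) (d (i, j) - d (i, j + 1))
                            else d (i, j) - d (i, j + 1))"

definition out_slope :: "nat \<Rightarrow> (vertex \<Rightarrow> real) \<Rightarrow> vertex \<Rightarrow> real" where
  "out_slope n d = (\<lambda>(i, j). if 1 < j then min (d (i - 1, j) - d (i, j)) (d (i, j - 1) - d (i, j))
                             else d (i - 1, j) - d (i, j))"

text \<open>\<open>p\<close> is a separate argument, so that either the minima of a solution or a
  prescribed filling can be put in its place.\<close>

definition critical :: "nat \<Rightarrow> (vertex \<Rightarrow> real) \<Rightarrow> (vertex \<Rightarrow> real) \<Rightarrow> bool" where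
  "critical n d p \<longleftrightarrow> (\<forall>v\<in>bullet_vertices n. p v = in_slope n d v \<and> p v = out_slope n d v)"

lemma mem_bullet_vertices [simp]: "(i, j) \<in> bullet_vertices n \<longleftrightarrow> 1 \<le> j \<and> j < i \<and> i \<le> n"
  by (auto simp: bullet_vertices_def)

lemma mem_filling_index [simp]: "(i, j) \<in> filling_index n \<longleftrightarrow> 1 \<le> i \<and> i < j \<and> j \<le> n"
  by (auto simp: filling_index_def)

lemma critical_in:
  assumes "critical n d p" "1 \<le> j" "j < i" "i \<le> n"
  shows "p (i, j) = (if i < n then min (d (i, j) - d (i + 1, j)) (d (i, j) - d (i, j + 1))
                     else d (i, j) - d (i, j + 1))"
  using bspec[OF assms(1)[unfolded critical_def], of "(i, j)"] assms by (simp add: in_slope_def)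

lemma critical_out:
  assumes "critical n d p" "1 \<le> j" "j < i" "i \<le> n"
  shows "p (i, j) = (if 1 < j then min (d (i - 1, j) - d (i, j)) (d (i, j - 1) - d (i, j))
                     else d (i - 1, j) - d (i, j))"
  using bspec[OF assms(1)[unfolded critical_def], of "(i, j)"] assms by (simp add: out_slope_def)

section \<open>Edges of a unit box\<close>

lemma critical_le:
  assumes "critical n d p" "1 \<le> j" "j \<le> i" "i < n"
  shows "p (i + 1, j) \<le> d (i + 1, j) - d (i + 1, j + 1)" "p (i + 1, j) \<le> d (i, j) - d (i + 1, j)"
  using critical_in[OF assms(1), of j "i + 1"] critical_out[OF assms(1), of j "i + 1"] assms(2-)
  by (auto split: if_splits)

text \<open>The first minimum compares the left and top edges of the box with upper left corner
  \<open>(i, j)\<close>, the second its right and bottom edges. As left + bottom = top + right, the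
  two minima are attained on opposite edges.\<close>

lemma critical_box:
  assumes "critical n d p" "1 \<le> j" "j < i" "i < n"
  shows "p (i, j) = min (d (i, j) - d (i + 1, j)) (d (i, j) - d (i, j + 1))"
    and "p (i + 1, j + 1) = min (d (i, j + 1) - d (i + 1, j + 1)) (d (i + 1, j) - d (i + 1, j + 1))"
  using critical_in[OF assms(1), of j i] critical_out[OF assms(1), of "j + 1" "i + 1"] assms(2-)
  by simp_all

lemma critical_le_left:
  assumes "critical n d p" "1 \<le> j" "j + 1 < i" "i \<le> n"
  shows "p (i, j + 1) \<le> d (i, j) - d (i, j + 1)"
  using critical_out[OF assms(1), of "j + 1" i] assms(2-) by simp

definition reflect :: "nat \<Rightarrow> (vertex \<Rightarrow> real) \<Rightarrow> vertex \<Rightarrow> real" where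
  "reflect n f = (\<lambda>(i, j). f (n + 1 - j, n + 1 - i))"

text \<open>Reflection in the antidiagonal reverses all arrows, hence the sign of the potential.\<close>

lemma critical_reflect:
  assumes "critical n d p"
  shows "critical n (\<lambda>v. - reflect n d v) (reflect n p)"
  unfolding critical_def
proof (clarify, rule conjI)
  fix i j assume "(i, j) \<in> bullet_vertices n"
  then have ij: "1 \<le> j" "j < i" "i \<le> n" by auto
  have shift: "n + 1 - (k - 1) = n + 1 - k + 1" "n + 1 - (k + 1) = n + 1 - k - 1" if "1 \<le> k" "k \<le> n" for k
    using that by auto
  have less: "i < n \<longleftrightarrow> 1 < n + 1 - i" "1 < j \<longleftrightarrow> n + 1 - j < n"
    using ij by auto
  have "in_slope n (\<lambda>v. - reflect n d v) (i, j) = out_slope n d (n + 1 - j, n + 1 - i)"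
    "out_slope n (\<lambda>v. - reflect n d v) (i, j) = in_slope n d (n + 1 - j, n + 1 - i)"
    unfolding in_slope_def out_slope_def reflect_def case_prod_conv less using ij
    by (simp_all only: shift) (simp_all add: min.commute)
  moreover have "(n + 1 - j, n + 1 - i) \<in> bullet_vertices n"
    using ij by auto
  ultimately show "reflect n p (i, j) = in_slope n (\<lambda>v. - reflect n d v) (i, j)"
    "reflect n p (i, j) = out_slope n (\<lambda>v. - reflect n d v) (i, j)"
    using assms unfolding critical_def reflect_def case_prod_conv by metis+
qed

section \<open>Monotonicity and the ideal condition\<close>

lemma critical_mono_left:
  assumes c: "critical n d p" and "1 \<le> j" "j + 1 < i" "i \<le> n"
  shows "p (i, j + 1) \<le> p (i, j)"
  using \<open>i \<le> n\<close> \<open>j + 1 < i\<close>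
proof (induction i rule: inc_induct)
  \<comment> \<open>In row \<open>n\<close> a single arrow enters \<open>(n, j)\<close>. It leaves
    \<open>(n, j + 1)\<close>, so its value bounds \<open>p (n, j + 1)\<close>.\<close>
  case base
  then show ?case
    using critical_in[OF c, of j n] critical_le_left[OF c, of j n] \<open>1 \<le> j\<close> by simp
next
  case (step i)
  have ij: "j < i" "i < n"
    using step by auto
  have "p (i + 1, j + 1) \<le> p (i + 1, j)"
    using step by simp
  \<comment> \<open>The top edge leaves \<open>(i, j + 1)\<close> and so bounds
    \<open>p (i, j + 1)\<close>. If instead the left edge is smaller, the right edge attains
    \<open>p (i + 1, j + 1)\<close>, and \<open>p (i, j + 1)\<close> <= right =
    \<open>p (i + 1, j + 1)\<close> <= \<open>p (i + 1, j)\<close> <= left =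
    \<open>p (i, j)\<close>.\<close>
  then show ?case
    using critical_box[OF c \<open>1 \<le> j\<close> ij] critical_box(1)[OF c _ \<open>j + 1 < i\<close> \<open>i < n\<close>]
      critical_le(2)[OF c \<open>1 \<le> j\<close> less_imp_le[OF ij(1)] ij(2)]
      critical_le_left[OF c \<open>1 \<le> j\<close> \<open>j + 1 < i\<close> less_imp_le[OF ij(2)]]
    by (simp add: min_def split: if_splits)
qed

lemma critical_mono_up:
  assumes c: "critical n d p" and "1 \<le> j" "j < i" "i < n"
  shows "p (i, j) \<le> p (i + 1, j)"
proof -
  have "reflect n p (n + 1 - j, n - i + 1) \<le> reflect n p (n + 1 - j, n - i)"
    using assms by (intro critical_mono_left[OF critical_reflect[OF c]]) auto
  then show ?thesis
    using assms by (simp add: reflect_def Suc_diff_Suc)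
qed

text \<open>The entry at the lower left corner is at most the left and the bottom edge. Either the
  left edge attains the minimum at the upper left corner or the bottom edge attains the one at the
  lower right corner. Monotonicity gives the other inequality.\<close>

lemma critical_ideal:
  assumes c: "critical n d p" and "1 \<le> j" "j < i" "i < n"
  shows "p (i + 1, j) = max (p (i, j)) (p (i + 1, j + 1))"
proof -
  have "p (i + 1, j) \<le> max (p (i, j)) (p (i + 1, j + 1))"
    using critical_box[OF assms] critical_le[OF c \<open>1 \<le> j\<close> less_imp_le[OF \<open>j < i\<close>] \<open>i < n\<close>]
    by (simp add: min_def max_def split: if_splits)
  with critical_mono_left[OF c, of j "i + 1"] critical_mono_up[OF c, of j i] assms
  show ?thesis by simp
qed

section \<open>Non-negativity\<close>

text \<open>A negative minimum over the subdiagonal would propagate down to the last row.\<close>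

lemma critical_subdiagonal_descent:
  assumes c: "critical n d p"
    and dom: "\<And>k. 1 \<le> k \<Longrightarrow> k < n \<Longrightarrow> d (k + 1, k + 1) \<le> d (k, k)"
    and least: "\<And>k. 1 \<le> k \<Longrightarrow> k < n \<Longrightarrow> m \<le> p (k + 1, k)" and "m < 0"
    and "1 \<le> k" "k < n" "p (k + 1, k) = m" "d (k + 1, k + 1) \<le> d (k + 1, k)"
  shows False
  using assms(5-)
proof (induction "n - k" arbitrary: k)
  case (Suc r)
  show ?case
  proof (cases "k + 1 < n")
    case False
    then show ?thesis
      using critical_in[OF c, of k "k + 1"] Suc.prems \<open>m < 0\<close> by simp
  next
    case True
    have "p (k + 1, k) \<le> p (k + 1 + 1, k)" "p (k + 2, k + 1) \<le> p (k + 2, k)"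
      using critical_mono_up[OF c, of k "k + 1"] critical_mono_left[OF c, of k "k + 2"] Suc.prems True by auto
    \<comment> \<open>The horizontal arrow into \<open>(k + 1, k)\<close> is non-negative, so the
      vertical one equals \<open>m\<close>. It bounds \<open>p (k + 2, k)\<close>, hence
      \<open>p (k + 2, k + 1)\<close>, which is \<open>m\<close> by minimality. As left < top in
      this box, the right edge is also \<open>m < 0\<close>; with \<open>dom\<close> this makes the
      next horizontal arrow non-negative.\<close>
    then have "p (k + 2, k + 1) = m \<and> d (k + 2, k + 2) \<le> d (k + 2, k + 1)"
      using critical_box[OF c, of k "k + 1"] critical_le(2)[OF c, of k "k + 1"]
        Suc.prems True \<open>m < 0\<close> least[of "k + 1"] dom[of "k + 1"]
      by (simp add: numeral_2_eq_2 min_def split: if_splits)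
    moreover have "r = n - (k + 1)"
      using Suc.hyps(2) by simp
    ultimately show ?thesis
      using Suc.hyps(1)[of "k + 1"] Suc.prems True by (simp add: numeral_2_eq_2)
  qed
qed simp

text \<open>Entries grow down each column, so the subdiagonal suffices. At its least entry,
  dominance makes the arrow from a star vertex or the arrow to a star vertex non-negative; the first
  case is the descent, the second its reflection.\<close>

lemma critical_nonneg:
  assumes c: "critical n d p"
    and dom: "\<And>k. 1 \<le> k \<Longrightarrow> k < n \<Longrightarrow> d (k + 1, k + 1) \<le> d (k, k)"
    and "1 \<le> j" "j < i" "i \<le> n"
  shows "0 \<le> p (i, j)"
proof -
  have sub: "0 \<le> p (k + 1, k)" if k: "1 \<le> k" "k < n" for k
  proof (rule ccontr)
    assume neg: "\<not> 0 \<le> p (k + 1, k)"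
    obtain k0 where k0: "k0 \<in> {1..<n}" and least: "\<And>k. k \<in> {1..<n} \<Longrightarrow> p (k0 + 1, k0) \<le> p (k + 1, k)"
      using ex_min_if_finite[of "(\<lambda>k. p (k + 1, k)) ` {1..<n}"] k by (force simp: not_less)
    have m: "p (k0 + 1, k0) < 0"
      using least[of k] k neg by simp
    show False
    proof (cases "d (k0 + 1, k0 + 1) \<le> d (k0 + 1, k0)")
      case True
      then show False
        using critical_subdiagonal_descent[OF c dom, of "p (k0 + 1, k0)" k0] least m k0 by simp
    next
      case False
      let ?d = "\<lambda>v. - reflect n d v" and ?p = "reflect n p"
      have p: "?p (k + 1, k) = p (n - k + 1, n - k)" if "k \<in> {1..<n}" for k
        using that by (simp add: reflect_def Suc_diff_le)
      have "?d (k + 1, k + 1) \<le> ?d (k, k)" if "1 \<le> k" "k < n" for k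
        using that dom[of "n - k"] by (simp add: reflect_def Suc_diff_le)
      moreover have "p (k0 + 1, k0) \<le> ?p (k + 1, k)" if "1 \<le> k" "k < n" for k
        using that least[of "n - k"] by (simp add: p del: One_nat_def)
      moreover have "?p (n - k0 + 1, n - k0) = p (k0 + 1, k0)"
        using k0 p[of "n - k0"] by auto
      \<comment> \<open>Reflection turns the vertical arrow out of \<open>(k0 + 1, k0)\<close> into
        the horizontal arrow into \<open>(n - k0 + 1, n - k0)\<close>.\<close>
      moreover have "?d (n - k0 + 1, n - k0 + 1) \<le> ?d (n - k0 + 1, n - k0)"
        using False dom[of k0] k0 by (simp add: reflect_def Suc_diff_le)
      ultimately show False
        using critical_subdiagonal_descent[OF critical_reflect[OF c], of "p (k0 + 1, k0)" "n - k0"] m k0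
        by (simp add: Suc_le_eq)
    qed
  qed
  show ?thesis
    using \<open>j < i\<close> \<open>i \<le> n\<close>
  proof (induction i)
    case (Suc i)
    show ?case
    proof (cases "j = i")
      case True
      then show ?thesis using sub[of j] \<open>1 \<le> j\<close> Suc.prems by simp
    next
      case False
      then show ?thesis
        using Suc critical_mono_up[OF c, of j i] \<open>1 \<le> j\<close> by simp
    qed
  qed simp
qed

section \<open>The potential of a filling\<close>

definition pot :: "nat \<Rightarrow> (vertex \<Rightarrow> real) \<Rightarrow> vertex \<Rightarrow> real" where
  "pot n p = (\<lambda>(i, j). (\<Sum>k\<in>{i<..n}. p (k, j)) - (\<Sum>k\<in>{1..<j}. p (i, k)))"

text \<open>The increment along a horizontal arrow is the entry at its head plus a correction by
  column differences; in \<open>pot_up\<close> it is the entry at the tail plus row differences. For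
  ideal fillings the corrections are non-negative.\<close>

lemma pot_left:
  "1 \<le> j \<Longrightarrow> pot n p (i, j) - pot n p (i, j + 1) = p (i, j) + (\<Sum>k\<in>{i<..n}. p (k, j) - p (k, j + 1))"
  by (simp add: pot_def sum_subtractf)

lemma greaterThanAtMost_step: "i < n \<Longrightarrow> {i<..n} = insert (i + 1) {i + 1<..n}" for i n :: nat
  by auto

lemma pot_up:
  "i < n \<Longrightarrow> pot n p (i, j) - pot n p (i + 1, j) = p (i + 1, j) + (\<Sum>k\<in>{1..<j}. p (i + 1, k) - p (i, k))"
  by (simp add: pot_def sum_subtractf greaterThanAtMost_step)

lemma pot_cong:
  assumes "\<And>v. v \<in> bullet_vertices n \<Longrightarrow> p v = q v" "1 \<le> j" "j \<le> i" "i \<le> n"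
  shows "pot n p (i, j) = pot n q (i, j)"
  using assms by (auto simp: pot_def intro!: arg_cong2[where f = "(-)"] sum.cong)

section \<open>Critical potentials are given by the formula\<close>

lemma critical_left_eq_pot:
  assumes c: "critical n d p" and "1 \<le> j" "j < i" "i \<le> n"
  shows "d (i, j) - d (i, j + 1) = pot n p (i, j) - pot n p (i, j + 1)"
  using \<open>i \<le> n\<close> \<open>j < i\<close>
proof (induction i rule: inc_induct)
  case base
  then show ?case
    using critical_in[OF c, of j n] \<open>1 \<le> j\<close> by (simp add: pot_left del: One_nat_def)
next
  case (step i)
  have "d (i + 1, j) - d (i + 1, j + 1) = pot n p (i + 1, j) - pot n p (i + 1, j + 1)"
    using step by simp
  moreover have "pot n p (i, j) - pot n p (i, j + 1) =
      pot n p (i + 1, j) - pot n p (i + 1, j + 1) + p (i, j) - p (i + 1, j + 1)"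
    using step.hyps \<open>1 \<le> j\<close> by (simp only: pot_left) (simp add: greaterThanAtMost_step)
  \<comment> \<open>The corner minima lie on opposite edges, so top - bottom = left - right =
    \<open>p (i, j) - p (i + 1, j + 1)\<close>, the same recursion as for
    \<open>pot\<close>.\<close>
  ultimately show ?case
    using critical_in[OF c, of j i] critical_out[OF c, of "j + 1" "i + 1"] step.hyps step.prems \<open>1 \<le> j\<close>
    by (simp add: min_def split: if_splits)
qed

text \<open>The same box identity is used from left to right, starting in column 1, where the only
  arrow out is vertical.\<close>

lemma critical_up_eq_pot:
  assumes c: "critical n d p" and "1 \<le> j" "j \<le> i" "i < n"
  shows "d (i, j) - d (i + 1, j) = pot n p (i, j) - pot n p (i + 1, j)"
  using \<open>1 \<le> j\<close> \<open>j \<le> i\<close>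
proof (induction j rule: dec_induct)
  case base
  then show ?case
    using critical_out[OF c, of 1 "i + 1"] \<open>i < n\<close> by (simp only: pot_up) simp
next
  case (step j)
  have "d (i, j) - d (i + 1, j) = pot n p (i, j) - pot n p (i + 1, j)"
    using step by simp
  moreover have "pot n p (i, j + 1) - pot n p (i + 1, j + 1) =
      pot n p (i, j) - pot n p (i + 1, j) + p (i + 1, j + 1) - p (i, j)"
    using step.hyps \<open>i < n\<close> by (simp only: pot_up) simp
  ultimately show ?case
    using critical_in[OF c, of j i] critical_out[OF c, of "j + 1" "i + 1"] step.hyps step.prems \<open>i < n\<close>
    by (simp add: min_def split: if_splits)
qed

lemma critical_diagonal_eq_pot:
  assumes c: "critical n d p" and "1 \<le> k" "k \<le> n"
  shows "pot n p (k, k) = d (k, k) + (pot n p (1, 1) - d (1, 1))"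
  using \<open>1 \<le> k\<close> \<open>k \<le> n\<close>
proof (induction k rule: dec_induct)
  case (step k)
  then show ?case
    using critical_left_eq_pot[OF c, of k "k + 1"] critical_up_eq_pot[OF c, of k k] by simp
qed simp

lemma critical_add_const: "critical n d p \<Longrightarrow> critical n (\<lambda>v. d v + c) p"
proof -
  have "in_slope n (\<lambda>v. d v + c) = in_slope n d" "out_slope n (\<lambda>v. d v + c) = out_slope n d"
    by (simp_all add: in_slope_def out_slope_def fun_eq_iff)
  then show "critical n d p \<Longrightarrow> critical n (\<lambda>v. d v + c) p"
    by (simp only: critical_def)
qed

section \<open>The formula is critical for ideal fillings\<close>

lemma critical_pot:
  assumes ideal: "\<And>i j. 1 \<le> j \<Longrightarrow> j < i \<Longrightarrow> i < n \<Longrightarrow> p (i + 1, j) = max (p (i, j)) (p (i + 1, j + 1))"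
  shows "critical n (pot n p) p"
proof -
  have left: "p (i, j) \<le> pot n p (i, j) - pot n p (i, j + 1)"
    if "1 \<le> j" "j < i" for i j
  proof -
    have "p (k, j + 1) \<le> p (k, j)" if "k \<in> {i<..n}" for k
      using ideal[of j "k - 1"] that \<open>1 \<le> j\<close> \<open>j < i\<close> by (cases k) auto
    then have "0 \<le> (\<Sum>k\<in>{i<..n}. p (k, j) - p (k, j + 1))"
      by (intro sum_nonneg) simp
    then show ?thesis
      using that by (simp only: pot_left)
  qed
  have up: "p (i + 1, j) \<le> pot n p (i, j) - pot n p (i + 1, j)"
    if "1 \<le> j" "j \<le> i" "i < n" for i j
  proof -
    have "p (i, k) \<le> p (i + 1, k)" if "k \<in> {1..<j}" for k
      using ideal[of k i] that \<open>j \<le> i\<close> \<open>i < n\<close> by simp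
    then have "0 \<le> (\<Sum>k\<in>{1..<j}. p (i + 1, k) - p (i, k))"
      by (intro sum_nonneg) simp
    then show ?thesis
      using that by (simp only: pot_up)
  qed
  \<comment> \<open>\<open>p (k + 1, j)\<close> is \<open>p (k + 1, j + 1)\<close> or
    \<open>p (k, j) = p (k, j + 1)\<close>, and the latter is at most
    \<open>p (k + 1, j + 1)\<close>. So equality of adjacent columns persists downwards;
    \<open>rows\<close> is the analogue leftwards.\<close>
  have columns: "p (k, j) = p (k, j + 1)"
    if "p (i, j) = p (i, j + 1)" "1 \<le> j" "j + 1 < i" "i \<le> k" "k \<le> n" for i j k
    using \<open>i \<le> k\<close> \<open>k \<le> n\<close>
  proof (induction k rule: dec_induct)
    case (step k)
    then show ?case
      using ideal[of j k] ideal[of "j + 1" k] that by simp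
  qed (use that in simp)
  have rows: "p (i + 1, k) = p (i, k)"
    if "p (i + 1, j) = p (i, j)" "1 \<le> k" "k \<le> j" "j < i" "i < n" for i j k
    using \<open>k \<le> j\<close> \<open>1 \<le> k\<close>
  proof (induction k rule: inc_induct)
    case (step k)
    then show ?case
      using ideal[of k i] ideal[of "k" "i - 1"] that by (cases "k + 1 < i") auto
  qed (use that in simp)
  \<comment> \<open>Equality in the term nearest to the arrow makes the whole correction vanish,
    here and in \<open>up_eq\<close>.\<close>
  have left_eq: "pot n p (i, j) - pot n p (i, j + 1) = p (i, j)"
    if "p (i + 1, j) = p (i + 1, j + 1) \<or> i = n" "1 \<le> j" "j < i" "i \<le> n" for i j
  proof -
    have "(\<Sum>k\<in>{i<..n}. p (k, j) - p (k, j + 1)) = 0"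
      using that columns[of "i + 1" j] by (intro sum.neutral) auto
    then show ?thesis
      using that by (simp only: pot_left)
  qed
  have up_eq: "pot n p (i, j) - pot n p (i + 1, j) = p (i + 1, j)"
    if "j = 1 \<or> p (i + 1, j - 1) = p (i, j - 1)" "1 \<le> j" "j \<le> i" "i < n" for i j
  proof -
    have "(\<Sum>k\<in>{1..<j}. p (i + 1, k) - p (i, k)) = 0"
      using that rows[of i "j - 1"] by (intro sum.neutral) auto
    then show ?thesis
      using that by (simp only: pot_up)
  qed
  show ?thesis
    unfolding critical_def
  proof (clarify, rule conjI)
    fix i j assume "(i, j) \<in> bullet_vertices n"
    then have ij: "1 \<le> j" "j < i" "i \<le> n" by auto
    show "p (i, j) = in_slope n (pot n p) (i, j)"
    proof (cases "i < n")
      case False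
      with left_eq[of i j] ij show ?thesis by (simp add: in_slope_def)
    next
      case True
      \<comment> \<open>Both arrows are at least \<open>p (i, j)\<close>, the vertical one since it
        is at least \<open>p (i + 1, j)\<close>. Whichever argument attains the maximum at
        \<open>(i + 1, j)\<close> makes the vertical or the horizontal arrow tight.\<close>
      have "pot n p (i, j) - pot n p (i + 1, j) = p (i, j)" if "p (i + 1, j) = p (i, j)"
        using up_eq[of j i] rows[of i j "j - 1"] that ij True by (cases "j = 1") auto
      moreover have "p (i + 1, j) = p (i, j) \<or> p (i + 1, j) = p (i + 1, j + 1)"
        "p (i, j) \<le> p (i + 1, j)"
        using ideal[of j i] ij True by auto
      ultimately show ?thesis
        using left[of j i] up[of j i] left_eq[of i j] ij True by (auto simp: in_slope_def)
    qed
    show "p (i, j) = out_slope n (pot n p) (i, j)"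
    proof (cases "1 < j")
      case False
      with up_eq[of j "i - 1"] ij show ?thesis by (simp add: out_slope_def)
    next
      case True
      then obtain k where k: "j = k + 1" "1 \<le> k" by (cases j) auto
      obtain h where h: "i = h + 1" "j \<le> h" using ij by (cases i) auto
      \<comment> \<open>The box now has lower right corner \<open>(i, j)\<close>, and the ideal
        condition is applied at its lower left corner \<open>(i, k)\<close>.\<close>
      have "pot n p (i, k) - pot n p (i, k + 1) = p (i, j)" if "p (i, k) = p (i, k + 1)"
        using left_eq[of i k] columns[of i k "i + 1"] that ij k by (cases "i = n") auto
      moreover have "p (h + 1, k) = p (h, k) \<or> p (i, k) = p (i, k + 1)"
        "p (i, k + 1) \<le> p (i, k)"
        using ideal[of k h] ij h k by auto
      ultimately show ?thesis
        using left[of k i] up[of j h] up_eq[of j h] ij h k by (auto simp: out_slope_def)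
    qed
  qed
qed

section \<open>Tropical solutions and ideal fillings\<close>

lemma arrows_into_bullet:
  assumes "1 \<le> j" "j < i" "i \<le> n"
  shows "arrows_into n (i, j) =
    (if i < n then {((i + 1, j), (i, j)), ((i, j + 1), (i, j))} else {((i, j + 1), (i, j))})"
  using assms by (auto simp: arrows_into_def arrows_def vertical_arrows_def horizontal_arrows_def)

lemma arrows_out_of_bullet:
  assumes "1 \<le> j" "j < i" "i \<le> n"
  shows "arrows_out_of n (i, j) =
    (if 1 < j then {((i, j), (i - 1, j)), ((i, j), (i, j - 1))} else {((i, j), (i - 1, j))})"
  using assms by (auto simp: arrows_out_of_def arrows_def vertical_arrows_def horizontal_arrows_def)

lemma Min_arrows_bullet:
  assumes \<sigma>: "\<And>a. a \<in> arrows n \<Longrightarrow> \<sigma> a = d (head a) - d (tail a)" and v: "v \<in> bullet_vertices n"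
  shows "Min (\<sigma> ` arrows_into n v) = in_slope n d v" "Min (\<sigma> ` arrows_out_of n v) = out_slope n d v"
proof -
  obtain i j where [simp]: "v = (i, j)" by force
  have "\<sigma> ` arrows_into n v = (\<lambda>a. d (head a) - d (tail a)) ` arrows_into n v"
    "\<sigma> ` arrows_out_of n v = (\<lambda>a. d (head a) - d (tail a)) ` arrows_out_of n v"
    using \<sigma> by (auto simp: arrows_into_def arrows_out_of_def intro!: image_cong)
  then show "Min (\<sigma> ` arrows_into n v) = in_slope n d v" "Min (\<sigma> ` arrows_out_of n v) = out_slope n d v"
    using v by (auto simp: arrows_into_bullet arrows_out_of_bullet in_slope_def out_slope_def)
qed

text \<open>Another representative shifts the potential by a constant and leaves the tuple
  unchanged, so one fixed \<open>l\<close> can prescribe the diagonal.\<close>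

lemma tropical_solutions_iff:
  "\<sigma> \<in> tropical_solutions n (weight_class n l) \<longleftrightarrow>
     \<sigma> \<in> arrows n \<rightarrow>\<^sub>E UNIV \<and>
     (\<exists>d. (\<forall>i\<in>{1..n}. d (i, i) = real_of_int (l i)) \<and>
          (\<forall>a\<in>arrows n. \<sigma> a = d (head a) - d (tail a)) \<and> critical n d (min_slope n \<sigma>))"
  (is "?L \<longleftrightarrow> ?R")
proof -
  have restr: "potential_differences n (restrict l {1..n}) = potential_differences n l"
    by (simp add: potential_differences_def)
  have self: "restrict l {1..n} \<in> weight_class n l"
    by (auto simp: weight_class_def diag_rel_def intro: exI[of _ 0])
  have "potential_differences n l' = potential_differences n l" if "l' \<in> weight_class n l" for l'
    using that potential_differences_cong[of "restrict l {1..n}" l' n] restr by (simp add: weight_class_def)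
  then have "?L \<longleftrightarrow> \<sigma> \<in> potential_differences n l \<and>
      (\<forall>v\<in>bullet_vertices n. Min (\<sigma> ` arrows_into n v) = Min (\<sigma> ` arrows_out_of n v))"
    using self restr unfolding tropical_solutions_def by blast
  moreover have "(\<forall>v\<in>bullet_vertices n. Min (\<sigma> ` arrows_into n v) = Min (\<sigma> ` arrows_out_of n v)) \<longleftrightarrow>
      critical n d (min_slope n \<sigma>)" if "\<forall>a\<in>arrows n. \<sigma> a = d (head a) - d (tail a)" for d
    using Min_arrows_bullet[of n \<sigma> d] that by (simp add: critical_def min_slope_def)
  ultimately show ?thesis
    unfolding potential_differences_def by blast
qed

section \<open>Weights of fillings\<close>

lemma weight_class_eq_iff:
  "weight_class n x = weight_class n y \<longleftrightarrow> (\<exists>c. \<forall>k\<in>{1..n}. x k = y k + c)"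
proof -
  have "weight_class n x = weight_class n y \<longleftrightarrow> weight_class n y = weight_class n x" by auto
  also have "\<dots> \<longleftrightarrow> (restrict y {1..n}, restrict x {1..n}) \<in> diag_rel n"
    unfolding weight_class_def by (rule eq_equiv_class_iff[OF equiv_diag_rel]) auto
  also have "\<dots> \<longleftrightarrow> (\<exists>c. \<forall>k\<in>{1..n}. x k = y k + c)"
    by (auto simp: diag_rel_def)
  finally show ?thesis .
qed

text \<open>Coordinate \<open>k\<close> collects the entries with first index \<open>k\<close> minus
  those with second index \<open>k\<close>. After transposition this is \<open>pot\<close> at a star
  vertex.\<close>

lemma sum_root_vec_eq_pot:
  assumes "1 \<le> k" "k \<le> n"
  shows "(\<Sum>(i, j)\<in>filling_index n. N (i, j) * root_vec i j k) = pot n (\<lambda>(i, j). N (j, i)) (k, k)"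
proof -
  have fin: "finite (filling_index n)"
    by (rule finite_subset[of _ "{1..n} \<times> {1..n}"]) auto
  have "(\<Sum>(i, j)\<in>filling_index n. N (i, j) * root_vec i j k) =
      (\<Sum>a\<in>filling_index n. if fst a = k then N a else 0) - (\<Sum>a\<in>filling_index n. if snd a = k then N a else 0)"
    by (subst sum_subtractf[symmetric]) (auto simp: root_vec_def eps_def intro!: sum.cong)
  also have "(\<Sum>a\<in>filling_index n. if fst a = k then N a else 0) = (\<Sum>j\<in>{k<..n}. N (k, j))"
  proof -
    have "{a \<in> filling_index n. fst a = k} = Pair k ` {k<..n}"
      using assms by auto
    then show ?thesis
      using fin by (simp add: sum.inter_filter[symmetric] sum.reindex inj_on_def)
  qed
  also have "(\<Sum>a\<in>filling_index n. if snd a = k then N a else 0) = (\<Sum>i\<in>{1..<k}. N (i, k))"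
  proof -
    have "{a \<in> filling_index n. snd a = k} = (\<lambda>i. (i, k)) ` {1..<k}"
      using assms by auto
    then show ?thesis
      using fin by (simp add: sum.inter_filter[symmetric] sum.reindex inj_on_def)
  qed
  finally show ?thesis
    by (simp add: pot_def)
qed

text \<open>Reindexing by \<open>(j, i + 1)\<close> turns the ideal condition into the box recursion
  of \<open>critical_ideal\<close>; \<open>c\<close> reflects that weights are classes modulo
  constants.\<close>

lemma ideal_fillings_for_iff:
  "N \<in> ideal_fillings_for n (weight_class n l) \<longleftrightarrow>
     N \<in> fillings n \<and>
     (\<forall>i j. 1 \<le> j \<longrightarrow> j < i \<longrightarrow> i < n \<longrightarrow> N (j, i + 1) = max (N (j, i)) (N (j + 1, i + 1))) \<and>
     (\<exists>c. \<forall>k\<in>{1..n}. pot n (\<lambda>(i, j). N (j, i)) (k, k) = real_of_int (l k) + c)"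
proof -
  have "(\<forall>(i, j)\<in>filling_index n. j - i \<ge> 2 \<longrightarrow> N (i, j) = max (N (i + 1, j)) (N (i, j - 1))) \<longleftrightarrow>
      (\<forall>i j. 1 \<le> j \<longrightarrow> j < i \<longrightarrow> i < n \<longrightarrow> N (j, i + 1) = max (N (j, i)) (N (j + 1, i + 1)))"
    (is "?A \<longleftrightarrow> ?B")
  proof
    assume A: ?A
    show ?B
    proof (intro allI impI)
      fix i j assume ij: "1 \<le> j" "j < i" "i < n"
      from A have "(\<lambda>(i, j). j - i \<ge> 2 \<longrightarrow> N (i, j) = max (N (i + 1, j)) (N (i, j - 1))) (j, i + 1)"
        by (rule bspec) (use ij in simp)
      with ij show "N (j, i + 1) = max (N (j, i)) (N (j + 1, i + 1))"
        by (simp add: max.commute)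
    qed
  next
    assume B: ?B
    show ?A
    proof (clarify)
      fix i j assume ij: "(i, j) \<in> filling_index n" "2 \<le> j - i"
      with B[rule_format, of i "j - 1"] show "N (i, j) = max (N (i + 1, j)) (N (i, j - 1))"
        by (cases j) (auto simp: max.commute)
    qed
  qed
  then show ?thesis
    unfolding ideal_fillings_for_def ideal_fillings_def real_weight_weight_class weight_class_eq_iff
    by (auto simp: sum_root_vec_eq_pot simp del: One_nat_def)
qed

section \<open>The correspondence\<close>

lemma arrow_cases:
  assumes "a \<in> arrows n"
  obtains (vertical) i j where "a = ((i + 1, j), (i, j))" "1 \<le> j" "j \<le> i" "i < n"
  | (horizontal) i j where "a = ((i, j + 1), (i, j))" "1 \<le> j" "j < i" "i \<le> n"
  using assms by (force simp: arrows_def vertical_arrows_def horizontal_arrows_def)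

text \<open>This recovers a solution from its filling alone, which yields injectivity and one
  direction of integrality.\<close>

lemma solution_eq_pot:
  assumes "\<sigma> \<in> tropical_solutions n (weight_class n l)" "a \<in> arrows n"
  shows "\<sigma> a = pot n (\<lambda>(i, j). filling_of n \<sigma> (j, i)) (head a) -
               pot n (\<lambda>(i, j). filling_of n \<sigma> (j, i)) (tail a)"
proof -
  let ?p = "min_slope n \<sigma>" and ?q = "\<lambda>(i, j). filling_of n \<sigma> (j, i)"
  obtain d where d: "\<sigma> a = d (head a) - d (tail a)" "critical n d ?p"
    using assms by (auto simp: tropical_solutions_iff)
  have "?q v = ?p v" if "v \<in> bullet_vertices n" for v
    using that by (cases v) (auto simp: filling_of_def)
  then have pot: "pot n ?q (i, j) = pot n ?p (i, j)" if "1 \<le> j" "j \<le> i" "i \<le> n" for i j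
    using that by (rule pot_cong)
  from assms(2) show ?thesis
  proof (cases rule: arrow_cases)
    case (vertical i j)
    then show ?thesis
      using d critical_up_eq_pot[OF d(2), of j i] pot[of j i] pot[of j "i + 1"] by simp
  next
    case (horizontal i j)
    then show ?thesis
      using d critical_left_eq_pot[OF d(2), of j i] pot[of j i] pot[of "j + 1" i] by simp
  qed
qed

lemma filling_of_solution:
  assumes dom: "\<And>k. 1 \<le> k \<Longrightarrow> k < n \<Longrightarrow> l (k + 1) \<le> l k"
    and \<sigma>: "\<sigma> \<in> tropical_solutions n (weight_class n l)"
  shows "filling_of n \<sigma> \<in> ideal_fillings_for n (weight_class n l)"
proof -
  let ?p = "min_slope n \<sigma>" and ?q = "\<lambda>(i, j). filling_of n \<sigma> (j, i)"
  obtain d where d: "\<And>i. i \<in> {1..n} \<Longrightarrow> d (i, i) = real_of_int (l i)" and c: "critical n d ?p"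
    using \<sigma> unfolding tropical_solutions_iff by blast
  have q: "filling_of n \<sigma> (j, i) = ?p (i, j)" if "1 \<le> j" "j < i" "i \<le> n" for i j
    using that by (simp add: filling_of_def)
  have "d (k + 1, k + 1) \<le> d (k, k)" if "1 \<le> k" "k < n" for k
    using d[of k] d[of "k + 1"] dom[of k] that by simp
  then have "0 \<le> ?p (i, j)" if "1 \<le> j" "j < i" "i \<le> n" for i j
    using that by (intro critical_nonneg[OF c])
  then have "filling_of n \<sigma> \<in> fillings n"
    by (auto simp: fillings_def filling_of_def PiE_iff)
  moreover have "filling_of n \<sigma> (j, i + 1) = max (filling_of n \<sigma> (j, i)) (filling_of n \<sigma> (j + 1, i + 1))"
    if "1 \<le> j" "j < i" "i < n" for i j
    using critical_ideal[OF c, of j i] that by (simp add: q)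
  moreover have "pot n ?q (k, k) = real_of_int (l k) + (pot n ?p (1, 1) - d (1, 1))" if "k \<in> {1..n}" for k
  proof -
    have "pot n ?q (k, k) = pot n ?p (k, k)"
      using that by (intro pot_cong) (auto simp: q)
    then show ?thesis
      using critical_diagonal_eq_pot[OF c, of k] d[of k] that by simp
  qed
  ultimately show ?thesis
    unfolding ideal_fillings_for_iff by blast
qed

lemma ideal_filling_has_solution:
  assumes N: "N \<in> ideal_fillings_for n (weight_class n l)"
  shows "\<exists>\<sigma>\<in>tropical_solutions n (weight_class n l). filling_of n \<sigma> = N"
proof -
  define p where "p = (\<lambda>(i, j). N (j, i))"
  obtain c where c: "\<And>k. k \<in> {1..n} \<Longrightarrow> pot n p (k, k) = real_of_int (l k) + c"
    using N unfolding ideal_fillings_for_iff p_def by blast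
  \<comment> \<open>Subtracting \<open>c\<close> makes the diagonal values equal to \<open>l\<close>
    and keeps all differences.\<close>
  define d where "d = (\<lambda>v. pot n p v + - c)"
  define \<sigma> where "\<sigma> = restrict (\<lambda>a. d (head a) - d (tail a)) (arrows n)"
  have crit: "critical n d p"
    unfolding d_def
  proof (rule critical_add_const, rule critical_pot)
    fix i j assume "1 \<le> j" "j < i" "i < n"
    with N show "p (i + 1, j) = max (p (i, j)) (p (i + 1, j + 1))"
      unfolding ideal_fillings_for_iff p_def case_prod_conv by blast
  qed
  have \<sigma>_eq: "\<sigma> a = d (head a) - d (tail a)" if "a \<in> arrows n" for a
    using that by (simp add: \<sigma>_def)
  have slope: "min_slope n \<sigma> v = p v" if v: "v \<in> bullet_vertices n" for v
  proof -
    have "min_slope n \<sigma> v = in_slope n d v"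
      unfolding min_slope_def by (rule Min_arrows_bullet(1)[OF \<sigma>_eq v])
    also have "\<dots> = p v"
      using bspec[OF crit[unfolded critical_def] v] by (rule conjunct1[THEN sym])
    finally show ?thesis .
  qed
  have "critical n d (min_slope n \<sigma>)"
    unfolding critical_def
  proof
    fix v assume v: "v \<in> bullet_vertices n"
    show "min_slope n \<sigma> v = in_slope n d v \<and> min_slope n \<sigma> v = out_slope n d v"
      unfolding slope[OF v] by (rule bspec[OF crit[unfolded critical_def] v])
  qed
  moreover have "\<forall>i\<in>{1..n}. d (i, i) = real_of_int (l i)"
    using c by (simp add: d_def)
  moreover have "\<sigma> \<in> arrows n \<rightarrow>\<^sub>E UNIV"
    by (simp add: \<sigma>_def)
  ultimately have "\<sigma> \<in> tropical_solutions n (weight_class n l)"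
    unfolding tropical_solutions_iff using \<sigma>_eq by blast
  moreover have "filling_of n \<sigma> = N"
  proof
    fix a :: "nat \<times> nat"
    obtain i j where [simp]: "a = (i, j)" by force
    show "filling_of n \<sigma> a = N a"
    proof (cases "a \<in> filling_index n")
      case True
      then show ?thesis using slope[of "(j, i)"] by (simp add: filling_of_def p_def)
    next
      \<comment> \<open>Off the index set both functions take the default value
        \<open>undefined\<close>.\<close>
      case False
      moreover have "N \<in> extensional (filling_index n)"
        using N by (auto simp: ideal_fillings_for_iff fillings_def PiE_def)
      ultimately show ?thesis
        using extensional_arb[of N "filling_index n" a] by (auto simp: filling_of_def)
    qed
  qed
  ultimately show ?thesis by blast
qed

text \<open>Each entry is a minimum attained at some arrow; conversely each arrow value is a
  difference of sums of entries.\<close>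

lemma solution_integral_iff:
  assumes \<sigma>: "\<sigma> \<in> tropical_solutions n (weight_class n l)"
  shows "(\<forall>a\<in>arrows n. \<sigma> a \<in> \<int>) \<longleftrightarrow> (\<forall>p\<in>filling_index n. filling_of n \<sigma> p \<in> \<int>)"
proof
  assume int: "\<forall>a\<in>arrows n. \<sigma> a \<in> \<int>"
  show "\<forall>p\<in>filling_index n. filling_of n \<sigma> p \<in> \<int>"
  proof clarify
    fix i j assume ij: "(i, j) \<in> filling_index n"
    then have v: "(j, i) \<in> bullet_vertices n" by simp
    have "Min (\<sigma> ` arrows_into n (j, i)) \<in> \<sigma> ` arrows_into n (j, i)"
      using arrows_at_bullet(1,2)[OF v] by (intro Min_in) auto
    then have "min_slope n \<sigma> (j, i) \<in> \<int>"
      using int unfolding min_slope_def arrows_into_def by auto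
    with ij show "filling_of n \<sigma> (i, j) \<in> \<int>"
      by (simp add: filling_of_def)
  qed
next
  assume int: "\<forall>p\<in>filling_index n. filling_of n \<sigma> p \<in> \<int>"
  have pot: "pot n (\<lambda>(i, j). filling_of n \<sigma> (j, i)) (i, j) \<in> \<int>" if "1 \<le> j" "j \<le> i" "i \<le> n" for i j
    using int that unfolding pot_def by (auto intro!: Ints_diff)
  show "\<forall>a\<in>arrows n. \<sigma> a \<in> \<int>"
  proof
    fix a assume a: "a \<in> arrows n"
    from a show "\<sigma> a \<in> \<int>"
      unfolding solution_eq_pot[OF \<sigma> a]
      by (cases rule: arrow_cases) (auto intro!: Ints_diff pot)
  qed
qed

theorem proposition6p2:
  fixes n :: nat and lam :: "(nat \<Rightarrow> int) set"
  assumes "n \<ge> 2" and "lam \<in> dominant_weights n"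
  shows "bij_betw (filling_of n) (tropical_solutions n lam) (ideal_fillings_for n lam) \<and>
         (\<forall>\<sigma>\<in>tropical_solutions n lam.
            (\<forall>a\<in>arrows n. \<sigma> a \<in> \<int>) \<longleftrightarrow> (\<forall>p\<in>filling_index n. filling_of n \<sigma> p \<in> \<int>))"
proof -
  obtain l where lam: "lam = weight_class n l" and l: "\<And>i j. 1 \<le> i \<Longrightarrow> i \<le> j \<Longrightarrow> j \<le> n \<Longrightarrow> l j \<le> l i"
    using assms(2) by (auto simp: dominant_weights_def)
  have "inj_on (filling_of n) (tropical_solutions n lam)"
  proof (rule inj_onI)
    fix \<sigma> \<tau> assume \<sigma>: "\<sigma> \<in> tropical_solutions n lam" and \<tau>: "\<tau> \<in> tropical_solutions n lam"
      and eq: "filling_of n \<sigma> = filling_of n \<tau>"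
    have "\<sigma> \<in> arrows n \<rightarrow>\<^sub>E UNIV" "\<tau> \<in> arrows n \<rightarrow>\<^sub>E UNIV"
      using \<sigma> \<tau> by (auto simp: lam tropical_solutions_iff)
    moreover have "\<sigma> a = \<tau> a" if "a \<in> arrows n" for a
      using that \<sigma> \<tau> eq by (simp add: lam solution_eq_pot)
    ultimately show "\<sigma> = \<tau>"
      by (rule PiE_ext)
  qed
  moreover have "filling_of n ` tropical_solutions n lam = ideal_fillings_for n lam"
    using filling_of_solution[of n l] ideal_filling_has_solution[of _ n l] l
    unfolding lam by (fastforce simp: image_iff)
  ultimately show ?thesis
    using solution_integral_iff lam by (auto simp: bij_betw_def)
qed

end
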